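(* Let $m,n\ge 2$ and let $(S,T)$ be an irreducible Cuntz-type atomic representation of type 2 or type 3b(i) of a single vertex $2$-graph $\mathbb{F}_\theta^+$ on a Hilbert space $\mathcal{H}$. Then $(S,T)$ has wandering vectors.
   Context: Single vertex $2$-graph: for positive integers $m,n$ and a permutation $\theta$ of $\{1,\ldots,m\}\times\{1,\ldots,n\}$, $\mathbb{F}_\theta^+$ is the unital cancellative semigroup generated by $e_1,\ldots,e_m,f_1,\ldots,f_n$, where the $e_i$ generate a copy of the free semigroup $\mathbb{F}_m^+$, the $f_j$ generate a copy of $\mathbb{F}_n^+$, and $e_if_j=f_{j'}e_{i'}$ whenever $\theta(i,j)=(i',j')$. Every $w\in\mathbb{F}_\theta^+$ is uniquely $w=e_uf_v$. A Cuntz-type representation $(S,T)$ on $\mathcal{H}$ consists of $S=[S_1,\ldots,S_m]$, $T=[T_1,\ldots,T_n]$ with $S_i^*S_j=\delta_{i,j}I$, $T_k^*T_l=\delta_{k,l}I$, $\sum_iS_iS_i^*=I=\sum_jT_jT_j^*$, and $S_iT_j=T_{j'}S_{i'}$ whenever $\theta(i,j)=(i',j')$. For $w=e_uf_v$, $(ST)_w=S_uT_v$. It is irreducible if it has no nontrivial closed reducing subspace. A representation is atomic if there is an orthonormal basis $\{\xi_k:k\ge0\}$ of $\mathcal{H}$ (the standard basis) such that each $(ST)_w$ maps each basis vector to a scalar in $\mathbb{T}\cup\{0\}$ times a basis vector. Write $\overline{\xi}=\{\lambda\xi:\lambda\in\mathbb{T}\}$. The graph of the representation has vertices $\overline{\xi_k}$,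 a blue edge from $\overline{\xi_i}$ to $\overline{\xi_j}$ if some $S_p\overline{\xi_i}=\overline{\xi_j}$, and a red edge if some $T_q\overline{\xi_i}=\overline{\xi_j}$. In the Cuntz-type case each vertex has exactly one blue and one red edge leading into it. $S$ is of ring type if every connected component of the blue graph contains a directed cycle, and of infinite tail type if the blue graph contains no directed cycle; similarly for $T$ with the red graph. Types of irreducible Cuntz-type atomic representations: Type 2a: $S$ is of ring type and $T$ is of infinite tail type. Type 2b: $T$ is of ring type and $S$ is of infinite tail type. Type 2 means type 2a or 2b. Type 3b(i): both $S$ and $T$ are of infinite tail type and there are a standard basis vector $\xi_0$ and nonempty words $u\in\mathbb{F}_m^+$, $v\in\mathbb{F}_n^+$ with $S_uT_v\overline{\xi_0}=\overline{\xi_0}$. A unit vector $\zeta\in\mathcal{H}$ is wandering for $(S,T)$ if $\langle(ST)_u\zeta,(ST)_w\zeta\rangle=\delta_{u,w}$ for all $u,w\in\mathbb{F}_\theta^+$. *)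

theory Defs
  imports "HOL-Analysis.Analysis" "HOL-Algebra.Group"
begin

section \<open>Complex Hilbert spaces\<close>

text \<open>The inner product is linear in the first argument. The norm, metric and completeness
  come from the library class \<open>banach\<close>.\<close>

class chilbert_space = banach +
  fixes scaleC :: "complex \<Rightarrow> 'a \<Rightarrow> 'a" (infixr "*\<^sub>C" 75)
    and cinner :: "'a \<Rightarrow> 'a \<Rightarrow> complex"
  assumes scaleC_add_right: "c *\<^sub>C (x + y) = c *\<^sub>C x + c *\<^sub>C y"
    and scaleC_add_left: "(c + d) *\<^sub>C x = c *\<^sub>C x + d *\<^sub>C x"
    and scaleC_scaleC: "c *\<^sub>C (d *\<^sub>C x) = (c * d) *\<^sub>C x"
    and scaleR_scaleC: "r *\<^sub>R x = complex_of_real r *\<^sub>C x"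
    and cinner_commute: "cinner x y = cnj (cinner y x)"
    and cinner_add_left: "cinner (x + y) z = cinner x z + cinner y z"
    and cinner_scaleC_left: "cinner (c *\<^sub>C x) y = c * cinner x y"
    and cinner_ge_zero: "0 \<le> Re (cinner x x)"
    and cinner_eq_zero_iff: "cinner x x = 0 \<longleftrightarrow> x = 0"
    and norm_eq_sqrt_cinner: "norm x = sqrt (Re (cinner x x))"

lemma vector_space_scaleC: "vector_space (scaleC :: complex \<Rightarrow> 'h::chilbert_space \<Rightarrow> 'h)"
  by unfold_locales
    (simp_all add: scaleC_add_right scaleC_add_left scaleC_scaleC
      scaleR_scaleC[of 1, simplified, symmetric])

definition bounded_clinear :: "('h::chilbert_space \<Rightarrow> 'h) \<Rightarrow> bool" where
  "bounded_clinear A \<longleftrightarrow> bounded_linear A \<and> (\<forall>c x. A (c *\<^sub>C x) = c *\<^sub>C A x)"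

text \<open>For bounded \<open>A\<close> the adjoint exists by the Riesz representation theorem, and it is unique.\<close>

definition cadjoint :: "('h::chilbert_space \<Rightarrow> 'h) \<Rightarrow> 'h \<Rightarrow> 'h" where
  "cadjoint A = (SOME B. \<forall>x y. cinner (A x) y = cinner x (B y))"

definition orthonormal_basis :: "(nat \<Rightarrow> 'h::chilbert_space) \<Rightarrow> bool" where
  "orthonormal_basis \<xi> \<longleftrightarrow>
     (\<forall>k l. cinner (\<xi> k) (\<xi> l) = (if k = l then 1 else 0)) \<and>
     closure (module.span scaleC (range \<xi>)) = UNIV"


section \<open>The semigroup of a single vertex 2-graph\<close>

text \<open>The index sets of the generators \<open>e\<^sub>i\<close> and \<open>f\<^sub>j\<close> are finite types \<open>'m\<close>, \<open>'n\<close>. A word in the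
  generators is a list over \<open>'m + 'n\<close>, with \<open>Inl i\<close> standing for \<open>e\<^sub>i\<close> and \<open>Inr j\<close> for \<open>f\<^sub>j\<close>.\<close>

type_synonym ('m, 'n) perm2 = "'m \<times> 'n \<Rightarrow> 'm \<times> 'n"

definition theta_step :: "('m, 'n) perm2 \<Rightarrow> (('m + 'n) list \<times> ('m + 'n) list) set" where
  "theta_step \<theta> =
     {(x @ [Inl i, Inr j] @ y, x @ [Inr j', Inl i'] @ y) | x y i j i' j'. \<theta> (i, j) = (i', j')}"

text \<open>Since \<open>theta_step\<close> is closed under left and right concatenation, its equivalence closure
  is the least monoid congruence containing the relations \<open>e\<^sub>i f\<^sub>j = f\<^sub>j\<^sub>' e\<^sub>i\<^sub>'\<close>.\<close>

definition theta_cong :: "('m, 'n) perm2 \<Rightarrow> (('m + 'n) list \<times> ('m + 'n) list) set" where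
  "theta_cong \<theta> = (theta_step \<theta> \<union> (theta_step \<theta>)\<inverse>)\<^sup>*"

definition F_theta :: "('m, 'n) perm2 \<Rightarrow> ('m + 'n) list set monoid" where
  "F_theta \<theta> = \<lparr>carrier = UNIV // theta_cong \<theta>,
     mult = (\<lambda>a b. theta_cong \<theta> `` {x @ y | x y. x \<in> a \<and> y \<in> b}),
     one = theta_cong \<theta> `` {[]}\<rparr>"

definition e_word :: "('m, 'n) perm2 \<Rightarrow> 'm list \<Rightarrow> ('m + 'n) list set" where
  "e_word \<theta> u = theta_cong \<theta> `` {map Inl u}"

definition f_word :: "('m, 'n) perm2 \<Rightarrow> 'n list \<Rightarrow> ('m + 'n) list set" where
  "f_word \<theta> v = theta_cong \<theta> `` {map Inr v}"

definition normal_form :: "('m, 'n) perm2 \<Rightarrow> ('m + 'n) list set \<Rightarrow> 'm list \<times> 'n list" where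
  "normal_form \<theta> w = (THE p. w = e_word \<theta> (fst p) \<otimes>\<^bsub>F_theta \<theta>\<^esub> f_word \<theta> (snd p))"

subsection \<open>The semigroup is a monoid with unique normal forms\<close>

lemma equiv_theta_cong: "equiv UNIV (theta_cong \<theta>)"
  unfolding theta_cong_def
  by (intro equivI refl_rtrancl sym_rtrancl trans_rtrancl sym_Un_converse) auto

lemma theta_cong_refl: "(x, x) \<in> theta_cong \<theta>"
  by (simp add: theta_cong_def)

lemma theta_cong_trans:
  "(x, y) \<in> theta_cong \<theta> \<Longrightarrow> (y, z) \<in> theta_cong \<theta> \<Longrightarrow> (x, z) \<in> theta_cong \<theta>"
  unfolding theta_cong_def by (rule rtrancl_trans)

lemma theta_step_context:
  assumes "(x, y) \<in> theta_step \<theta>"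
  shows "(a @ x @ b, a @ y @ b) \<in> theta_step \<theta>"
proof -
  obtain p q i j i' j' where *: "x = p @ [Inl i, Inr j] @ q" "y = p @ [Inr j', Inl i'] @ q"
    "\<theta> (i, j) = (i', j')"
    using assms unfolding theta_step_def by blast
  have "a @ x @ b = (a @ p) @ [Inl i, Inr j] @ (q @ b)"
    "a @ y @ b = (a @ p) @ [Inr j', Inl i'] @ (q @ b)"
    by (simp_all add: *)
  then show ?thesis
    using *(3) unfolding theta_step_def by blast
qed

lemma theta_cong_context:
  assumes "(x, y) \<in> theta_cong \<theta>"
  shows "(a @ x @ b, a @ y @ b) \<in> theta_cong \<theta>"
  using assms unfolding theta_cong_def
proof (induction rule: rtrancl_induct)
  case (step y z)
  then have "(a @ y @ b, a @ z @ b) \<in> theta_step \<theta> \<union> (theta_step \<theta>)\<inverse>"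
    using theta_step_context by blast
  with step.IH show ?case by (rule rtrancl_into_rtrancl)
qed simp

lemma theta_cong_append:
  assumes "(x, x') \<in> theta_cong \<theta>" "(y, y') \<in> theta_cong \<theta>"
  shows "(x @ y, x' @ y') \<in> theta_cong \<theta>"
  using theta_cong_context[OF assms(1), of "[]" y] theta_cong_context[OF assms(2), of x' "[]"]
  by (auto intro: theta_cong_trans)

lemma theta_class_eq_iff:
  "theta_cong \<theta> `` {x} = theta_cong \<theta> `` {y} \<longleftrightarrow> (x, y) \<in> theta_cong \<theta>"
  using eq_equiv_class_iff[OF equiv_theta_cong] by blast

lemma mult_F_theta:
  "theta_cong \<theta> `` {x} \<otimes>\<^bsub>F_theta \<theta>\<^esub> theta_cong \<theta> `` {y} = theta_cong \<theta> `` {x @ y}"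
  unfolding F_theta_def
  by (auto intro: theta_cong_trans theta_cong_append theta_cong_refl)

lemma monoid_F_theta: "monoid (F_theta \<theta>)"
proof -
  have c: "a \<in> carrier (F_theta \<theta>) \<longleftrightarrow> (\<exists>x. a = theta_cong \<theta> `` {x})" for a
    by (auto simp: F_theta_def quotient_def)
  have o: "\<one>\<^bsub>F_theta \<theta>\<^esub> = theta_cong \<theta> `` {[]}"
    by (simp add: F_theta_def)
  show ?thesis
    by unfold_locales (auto simp only: c o mult_F_theta append.simps append_Nil2 append_assoc)
qed

fun push :: "('m, 'n) perm2 \<Rightarrow> 'n \<Rightarrow> 'm list \<Rightarrow> 'm list \<times> 'n" where
  "push \<theta> j [] = ([], j)"
| "push \<theta> j (i # u) =
     (let (i', j') = inv_into UNIV \<theta> (i, j); (u', j'') = push \<theta> j' u in (i' # u', j''))"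

fun act :: "('m, 'n) perm2 \<Rightarrow> 'm + 'n \<Rightarrow> 'm list \<times> 'n list \<Rightarrow> 'm list \<times> 'n list" where
  "act \<theta> (Inl i) (u, v) = (i # u, v)"
| "act \<theta> (Inr j) (u, v) = (let (u', j') = push \<theta> j u in (u', j' # v))"

lemma foldr_act_theta_cong:
  assumes "bij \<theta>" "(x, y) \<in> theta_cong \<theta>"
  shows "foldr (act \<theta>) x p = foldr (act \<theta>) y p"
proof -
  have step: "foldr (act \<theta>) x p = foldr (act \<theta>) y p" if "(x, y) \<in> theta_step \<theta>" for x y
  proof -
    have swap: "act \<theta> (Inl i) (act \<theta> (Inr j) q) = act \<theta> (Inr j') (act \<theta> (Inl i') q)"
      if "\<theta> (i, j) = (i', j')" for i j i' j' q
    proof -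
      have "inv_into UNIV \<theta> (i', j') = (i, j)"
        using that assms(1) by (metis bij_inv_eq_iff)
      then show ?thesis
        by (cases q) (auto split: prod.splits)
    qed
    from that obtain a b i j i' j' where *: "x = a @ [Inl i, Inr j] @ b"
      "y = a @ [Inr j', Inl i'] @ b" "\<theta> (i, j) = (i', j')"
      unfolding theta_step_def by blast
    show ?thesis
      using swap[OF *(3)] by (simp add: *(1,2) del: act.simps)
  qed
  show ?thesis
    using assms(2) unfolding theta_cong_def
    by (induction rule: rtrancl_induct) (auto dest: step)
qed

lemma foldr_act_normal: "foldr (act \<theta>) (map Inl u @ map Inr v) ([], []) = (u, v)"
proof -
  have "foldr (act \<theta>) (map Inr v) ([], []) = ([], v)"
    by (induction v) auto
  moreover have "foldr (act \<theta>) (map Inl u) ([], v) = (u, v)"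
    by (induction u) auto
  ultimately show ?thesis by simp
qed

lemma push_theta_cong:
  assumes "bij \<theta>" "push \<theta> j u = (u', j')"
  shows "(Inr j # map Inl u, map Inl u' @ [Inr j']) \<in> theta_cong \<theta>"
  using assms(2)
proof (induction u arbitrary: j u')
  case Nil
  then show ?case by (simp add: theta_cong_refl)
next
  case (Cons i u)
  obtain i1 j1 where 1: "inv_into UNIV \<theta> (i, j) = (i1, j1)" by fastforce
  obtain u2 where 2: "push \<theta> j1 u = (u2, j')" "u' = i1 # u2"
    using Cons.prems 1 by (auto split: prod.splits)
  have "\<theta> (i1, j1) = (i, j)"
    using 1 assms(1) by (metis bij_inv_eq_iff)
  then have "([] @ [Inl i1, Inr j1] @ map Inl u, [] @ [Inr j, Inl i] @ map Inl u) \<in> theta_step \<theta>"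
    unfolding theta_step_def by blast
  then have "(Inr j # Inl i # map Inl u, Inl i1 # Inr j1 # map Inl u) \<in> theta_cong \<theta>"
    unfolding theta_cong_def by (auto intro!: r_into_rtrancl)
  moreover have "(Inl i1 # Inr j1 # map Inl u, Inl i1 # map Inl u2 @ [Inr j']) \<in> theta_cong \<theta>"
    using theta_cong_context[OF Cons.IH[OF 2(1)], of "[Inl i1]" "[]"] by simp
  ultimately show ?case
    using 2(2) by (auto intro: theta_cong_trans)
qed

lemma normal_form_exists:
  assumes "bij \<theta>"
  shows "\<exists>u v. (x, map Inl u @ map Inr v) \<in> theta_cong \<theta>"
proof (induction x)
  case Nil
  have "([], map Inl [] @ map Inr []) \<in> theta_cong \<theta>"
    by (simp add: theta_cong_refl)
  then show ?case by blast
next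
  case (Cons a x)
  then obtain u v where uv: "(x, map Inl u @ map Inr v) \<in> theta_cong \<theta>" by blast
  have *: "(a # x, a # map Inl u @ map Inr v) \<in> theta_cong \<theta>"
    using theta_cong_context[OF uv, of "[a]" "[]"] by simp
  show ?case
  proof (cases a)
    case (Inl i)
    then show ?thesis
      using * by (intro exI[of _ "i # u"] exI[of _ v]) simp
  next
    case (Inr j)
    obtain u' j' where p: "push \<theta> j u = (u', j')" by fastforce
    have "(a # map Inl u @ map Inr v, map Inl u' @ map Inr (j' # v)) \<in> theta_cong \<theta>"
      using theta_cong_context[OF push_theta_cong[OF assms p], of "[]" "map Inr v"] Inr by simp
    with * show ?thesis by (blast intro: theta_cong_trans)
  qed
qed

lemma normal_form_unique:
  assumes "bij \<theta>" "w \<in> carrier (F_theta \<theta>)"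
  shows "\<exists>!p. w = e_word \<theta> (fst p) \<otimes>\<^bsub>F_theta \<theta>\<^esub> f_word \<theta> (snd p)"
proof -
  obtain x where w: "w = theta_cong \<theta> `` {x}"
    using assms(2) by (auto simp: F_theta_def quotient_def)
  have *: "w = e_word \<theta> (fst p) \<otimes>\<^bsub>F_theta \<theta>\<^esub> f_word \<theta> (snd p) \<longleftrightarrow>
      (x, map Inl (fst p) @ map Inr (snd p)) \<in> theta_cong \<theta>" for p
    by (simp only: w e_word_def f_word_def mult_F_theta theta_class_eq_iff)
  obtain u v where "(x, map Inl u @ map Inr v) \<in> theta_cong \<theta>"
    using normal_form_exists[OF assms(1)] by blast
  moreover have "p = foldr (act \<theta>) x ([], [])"
    if "(x, map Inl (fst p) @ map Inr (snd p)) \<in> theta_cong \<theta>" for p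
    using foldr_act_theta_cong[OF assms(1) that, of "([], [])"] by (simp only: foldr_act_normal) simp
  ultimately show ?thesis
    unfolding * by (metis fst_conv snd_conv)
qed


section \<open>Cuntz-type representations\<close>

definition cuntz_family :: "('i::finite \<Rightarrow> 'h::chilbert_space \<Rightarrow> 'h) \<Rightarrow> bool" where
  "cuntz_family A \<longleftrightarrow>
     (\<forall>i. bounded_clinear (A i)) \<and>
     (\<forall>i j x. cadjoint (A i) (A j x) = (if i = j then x else 0)) \<and>
     (\<forall>x. (\<Sum>i\<in>UNIV. A i (cadjoint (A i) x)) = x)"

definition cuntz_type_rep ::
  "('m::finite, 'n::finite) perm2 \<Rightarrow> ('m \<Rightarrow> 'h::chilbert_space \<Rightarrow> 'h) \<Rightarrow> ('n \<Rightarrow> 'h \<Rightarrow> 'h) \<Rightarrow> bool"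
  where
  "cuntz_type_rep \<theta> S T \<longleftrightarrow>
     cuntz_family S \<and> cuntz_family T \<and>
     (\<forall>i j i' j'. \<theta> (i, j) = (i', j') \<longrightarrow> S i \<circ> T j = T j' \<circ> S i')"

text \<open>\<open>foldr A [i\<^sub>1, \<dots>, i\<^sub>k]\<close> is the operator \<open>A i\<^sub>1 \<circ> \<dots> \<circ> A i\<^sub>k\<close>.\<close>

definition rep_op :: "('m, 'n) perm2 \<Rightarrow> ('m \<Rightarrow> 'h \<Rightarrow> 'h) \<Rightarrow> ('n \<Rightarrow> 'h \<Rightarrow> 'h) \<Rightarrow>
    ('m + 'n) list set \<Rightarrow> 'h \<Rightarrow> 'h" where
  "rep_op \<theta> S T w = (case normal_form \<theta> w of (u, v) \<Rightarrow> foldr S u \<circ> foldr T v)"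

definition reducing :: "('i \<Rightarrow> 'h::chilbert_space \<Rightarrow> 'h) \<Rightarrow> 'h set \<Rightarrow> bool" where
  "reducing A V \<longleftrightarrow> (\<forall>i. A i ` V \<subseteq> V \<and> cadjoint (A i) ` V \<subseteq> V)"

definition irreducible_rep ::
  "('m \<Rightarrow> 'h::chilbert_space \<Rightarrow> 'h) \<Rightarrow> ('n \<Rightarrow> 'h \<Rightarrow> 'h) \<Rightarrow> bool" where
  "irreducible_rep S T \<longleftrightarrow>
     (\<forall>V. module.subspace scaleC V \<and> closed V \<and> reducing S V \<and> reducing T V \<longrightarrow>
        V = {0} \<or> V = UNIV)"

definition wandering :: "('m, 'n) perm2 \<Rightarrow> ('m \<Rightarrow> 'h::chilbert_space \<Rightarrow> 'h) \<Rightarrow>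
    ('n \<Rightarrow> 'h \<Rightarrow> 'h) \<Rightarrow> 'h \<Rightarrow> bool" where
  "wandering \<theta> S T \<zeta> \<longleftrightarrow> norm \<zeta> = 1 \<and>
     (\<forall>u \<in> carrier (F_theta \<theta>). \<forall>w \<in> carrier (F_theta \<theta>).
        cinner (rep_op \<theta> S T u \<zeta>) (rep_op \<theta> S T w \<zeta>) = (if u = w then 1 else 0))"


section \<open>Atomic representations and their types\<close>

definition atomic_wrt :: "('m, 'n) perm2 \<Rightarrow> ('m \<Rightarrow> 'h::chilbert_space \<Rightarrow> 'h) \<Rightarrow>
    ('n \<Rightarrow> 'h \<Rightarrow> 'h) \<Rightarrow> (nat \<Rightarrow> 'h) \<Rightarrow> bool" where
  "atomic_wrt \<theta> S T \<xi> \<longleftrightarrow> orthonormal_basis \<xi> \<and>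
     (\<forall>w \<in> carrier (F_theta \<theta>). \<forall>k. \<exists>c l. (cmod c = 1 \<or> c = 0) \<and>
        rep_op \<theta> S T w (\<xi> k) = c *\<^sub>C \<xi> l)"

definition unit_orbit :: "'h::chilbert_space \<Rightarrow> 'h set" where
  "unit_orbit x = {c *\<^sub>C x | c. cmod c = 1}"

text \<open>The blue graph is given by \<open>edges S \<xi>\<close>, the red graph by \<open>edges T \<xi>\<close>.\<close>

definition vertices :: "(nat \<Rightarrow> 'h::chilbert_space) \<Rightarrow> 'h set set" where
  "vertices \<xi> = range (\<lambda>k. unit_orbit (\<xi> k))"

definition edges :: "('i \<Rightarrow> 'h::chilbert_space \<Rightarrow> 'h) \<Rightarrow> (nat \<Rightarrow> 'h) \<Rightarrow> ('h set \<times> 'h set) set" where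
  "edges A \<xi> = {(x, y). x \<in> vertices \<xi> \<and> y \<in> vertices \<xi> \<and> (\<exists>p. A p ` x = y)}"

definition components :: "'v set \<Rightarrow> ('v \<times> 'v) set \<Rightarrow> 'v set set" where
  "components V E = V // (E \<union> E\<inverse>)\<^sup>*"

text \<open>Loops count as directed cycles.\<close>

definition ring_type :: "('i \<Rightarrow> 'h::chilbert_space \<Rightarrow> 'h) \<Rightarrow> (nat \<Rightarrow> 'h) \<Rightarrow> bool" where
  "ring_type A \<xi> \<longleftrightarrow>
     (\<forall>C \<in> components (vertices \<xi>) (edges A \<xi>). \<not> acyclic (edges A \<xi> \<inter> C \<times> C))"

definition infinite_tail_type :: "('i \<Rightarrow> 'h::chilbert_space \<Rightarrow> 'h) \<Rightarrow> (nat \<Rightarrow> 'h) \<Rightarrow> bool" where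
  "infinite_tail_type A \<xi> \<longleftrightarrow> acyclic (edges A \<xi>)"

definition type_2a :: "('m \<Rightarrow> 'h::chilbert_space \<Rightarrow> 'h) \<Rightarrow> ('n \<Rightarrow> 'h \<Rightarrow> 'h) \<Rightarrow>
    (nat \<Rightarrow> 'h) \<Rightarrow> bool" where
  "type_2a S T \<xi> \<longleftrightarrow> ring_type S \<xi> \<and> infinite_tail_type T \<xi>"

definition type_2b :: "('m \<Rightarrow> 'h::chilbert_space \<Rightarrow> 'h) \<Rightarrow> ('n \<Rightarrow> 'h \<Rightarrow> 'h) \<Rightarrow>
    (nat \<Rightarrow> 'h) \<Rightarrow> bool" where
  "type_2b S T \<xi> \<longleftrightarrow> ring_type T \<xi> \<and> infinite_tail_type S \<xi>"

definition type_2 :: "('m \<Rightarrow> 'h::chilbert_space \<Rightarrow> 'h) \<Rightarrow> ('n \<Rightarrow> 'h \<Rightarrow> 'h) \<Rightarrow>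
    (nat \<Rightarrow> 'h) \<Rightarrow> bool" where
  "type_2 S T \<xi> \<longleftrightarrow> type_2a S T \<xi> \<or> type_2b S T \<xi>"

definition type_3bi :: "('m \<Rightarrow> 'h::chilbert_space \<Rightarrow> 'h) \<Rightarrow> ('n \<Rightarrow> 'h \<Rightarrow> 'h) \<Rightarrow>
    (nat \<Rightarrow> 'h) \<Rightarrow> bool" where
  "type_3bi S T \<xi> \<longleftrightarrow> infinite_tail_type S \<xi> \<and> infinite_tail_type T \<xi> \<and>
     (\<exists>k u v. u \<noteq> [] \<and> v \<noteq> [] \<and>
        (foldr S u \<circ> foldr T v) ` unit_orbit (\<xi> k) = unit_orbit (\<xi> k))"

end

theory Submission
  imports Defs
begin

text \<open>A Cuntz-type atomic representation is carried by two families of maps on the indices of the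
  standard basis, each with disjoint ranges that cover all indices. Hence every index has a unique
  blue parent \<open>f\<close> and a unique red parent \<open>g\<close>, and the maps \<open>f\<close>, \<open>g\<close> commute. A standard basis
  vector \<open>\<xi> x\<close> is wandering once neither \<open>f\<^sup>a g\<^sup>b x = x\<close> nor \<open>f\<^sup>a x = g\<^sup>b x\<close> has a solution other
  than \<open>a = b = 0\<close>. Types 2 and 3b(i) provide \<open>z\<close> with \<open>f\<^sup>p g\<^sup>q z = z\<close>, up to exchanging the colours
  with \<open>p > 0\<close>, and the missing cycles force every other period of \<open>z\<close>, or of a child of \<open>z\<close>, to
  be proportional to \<open>(p, q)\<close>. If two distinct children of \<open>z\<close> were periodic, they would share a
  period \<open>(N p, N q)\<close>; as \<open>p > 0\<close>, applying \<open>f\<^sup>N\<^sup>p g\<^sup>N\<^sup>q\<close> factors through \<open>z\<close> and identifies them.\<close>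

section \<open>Commuting maps\<close>

locale commuting_maps =
  fixes f g :: "'v \<Rightarrow> 'v"
  assumes comm: "f (g x) = g (f x)"
begin

text \<open>The action of pairs of naturals given by the commuting maps. For parent maps,
  \<open>F a b x\<close> is the ancestor of \<open>x\<close> after \<open>a\<close> blue and
  \<open>b\<close> red steps.\<close>

definition F :: "nat \<Rightarrow> nat \<Rightarrow> 'v \<Rightarrow> 'v" where
  "F a b x = (f ^^ a) ((g ^^ b) x)"

lemma f_funpow_g: "f ((g ^^ b) x) = (g ^^ b) (f x)"
  by (induction b) (simp_all add: comm)

lemma funpow_comm: "(f ^^ a) ((g ^^ b) x) = (g ^^ b) ((f ^^ a) x)"
  by (induction a) (simp_all add: f_funpow_g)

lemma F_add: "F (a + a') (b + b') x = F a b (F a' b' x)"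
  by (simp add: F_def funpow_add funpow_comm)

lemma F_f: "F a b (f x) = f (F a b x)"
  by (simp add: F_def f_funpow_g[symmetric] funpow_swap1)

lemma F_mult:
  assumes "F a b x = x" shows "F (a * N) (b * N) x = x"
proof (induction N)
  case (Suc N)
  then show ?case
    using F_add[of a "a * N" b "b * N" x] assms by simp
qed (simp add: F_def)

text \<open>The two clauses exclude periods with coordinates of equal and of opposite sign, hence
  every nonzero period in the integer plane.\<close>

definition aperiodic_at :: "'v \<Rightarrow> bool" where
  "aperiodic_at x \<longleftrightarrow> (\<forall>a b. F a b x = x \<longrightarrow> a = 0 \<and> b = 0)
     \<and> (\<forall>a b. (f ^^ a) x = (g ^^ b) x \<longrightarrow> a = 0 \<and> b = 0)"

text \<open>Scale both periods to the same blue degree \<open>a * p\<close>. If the red degrees then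
  differed, cancelling the common part would leave a red cycle at \<open>z\<close>.\<close>

lemma period_proportional:
  assumes g: "\<And>n x. n > 0 \<Longrightarrow> (g ^^ n) x \<noteq> x"
    and "F p q z = z" "F a b z = z"
  shows "a * q = b * p"
proof -
  have *: "F (a * p) (b * p) z = z" "F (a * p) (q * a) z = z"
    using F_mult[OF assms(3), of p] F_mult[OF assms(2), of a] by (simp_all add: mult.commute)
  have no_gap: "\<not> c < d" if "F r c z = z" "F r d z = z" for r c d
  proof
    assume "c < d"
    have "(g ^^ (d - c)) z = z"
      using F_add[of 0 r "d - c" c z] that \<open>c < d\<close> by (simp add: F_def)
    with g[of "d - c" z] \<open>c < d\<close> show False by simp
  qed
  show ?thesis
    using no_gap[OF *] no_gap[OF *(2,1)] by (simp add: mult.commute)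
qed

text \<open>The case \<open>q = 0\<close> serves type 2, where the period is a blue cycle; the
  alternative serves type 3b(i). Having two children excludes periods of equal sign; one of opposite
  sign is moved up to \<open>z\<close> and compared with the period there.\<close>

lemma aperiodic_child:
  assumes g: "\<And>n x. n > 0 \<Longrightarrow> (g ^^ n) x \<noteq> x"
    and f: "q = 0 \<or> (\<forall>n x. n > 0 \<longrightarrow> (f ^^ n) x \<noteq> x)"
    and z: "F p q z = z" and p: "p > 0"
    and ch: "f x1 = z" "f x2 = z" "x1 \<noteq> x2"
  shows "\<exists>x. aperiodic_at x"
proof -
  \<comment> \<open>A period of a child is also one of \<open>z\<close>, hence proportional to
    \<open>(p, q)\<close>. Its multiple by \<open>p\<close> equals \<open>(p * a, q * a)\<close>, so
    \<open>N = a\<close> works.\<close>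
  have period: "\<exists>N>0. F (p * N) (q * N) x = x"
    if "f x = z" "F a b x = x" "\<not> (a = 0 \<and> b = 0)" for x a b
  proof -
    have "F a b z = z" using F_f[of a b x] that by simp
    then have aq: "a * q = b * p" by (rule period_proportional[OF _ z, rotated]) (rule g)
    have "a > 0" using aq p that(3) by (cases "a = 0") auto
    moreover have "F (p * a) (q * a) x = x"
      using F_mult[OF that(2), of p] aq by (simp add: mult.commute)
    ultimately show ?thesis by blast
  qed
  have one: "\<exists>x\<in>{x1, x2}. \<forall>a b. F a b x = x \<longrightarrow> a = 0 \<and> b = 0"
  proof (rule ccontr)
    assume no: "\<not> ?thesis"
    obtain N1 where N1: "N1 > 0" "F (p * N1) (q * N1) x1 = x1"
      using no period[OF ch(1)] by blast
    obtain N2 where N2: "N2 > 0" "F (p * N2) (q * N2) x2 = x2"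
      using no period[OF ch(2)] by blast
    define M where "M = N1 * N2"
    have M: "F (p * M) (q * M) x1 = x1" "F (p * M) (q * M) x2 = x2"
      using F_mult[OF N1(2), of N2] F_mult[OF N2(2), of N1]
      by (simp_all add: M_def mult.assoc mult.commute[of N1 N2])
    have "p * M > 0" using N1 N2 p by (simp add: M_def)
    then have "F (p * M) (q * M) x = F (p * M - 1) (q * M) (f x)" for x
      using F_add[of "p * M - 1" 1 "q * M" 0 x] by (simp add: F_def)
    with M ch show False by metis
  qed
  then obtain x where x: "f x = z" and A: "\<And>a b. F a b x = x \<Longrightarrow> a = 0 \<and> b = 0"
    using ch by blast
  have "a = 0 \<and> b = 0" if e: "(f ^^ a) x = (g ^^ b) x" for a b
  proof -
    have "(f ^^ a) (f x) = (g ^^ b) (f x)"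
      using arg_cong[OF e, of f] by (simp add: f_funpow_g funpow_swap1)
    then have fg: "(f ^^ a) z = (g ^^ b) z" using x by simp
    have iter: "(f ^^ (a * N)) z = (g ^^ (b * N)) z" for N
    proof (induction N)
      case (Suc N)
      have "(f ^^ (a * Suc N)) z = (f ^^ a) ((f ^^ (a * N)) z)"
        by (simp add: funpow_add)
      also have "\<dots> = (g ^^ (b * N)) ((f ^^ a) z)"
        by (simp add: Suc funpow_comm)
      also have "\<dots> = (g ^^ (b * N + b)) z"
        by (simp add: fg funpow_add)
      finally show ?case by (simp add: add.commute)
    qed simp
    show ?thesis
    proof (cases "q = 0")
      \<comment> \<open>Here \<open>f ^^ p\<close> fixes \<open>z\<close>, so \<open>iter\<close> at
        \<open>p\<close> gives a red cycle unless \<open>b = 0\<close>. Then \<open>e\<close> is a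
        period \<open>(a, 0)\<close> of \<open>x\<close>, which \<open>A\<close> excludes.\<close>
      case True
      then have "(f ^^ (a * p)) z = z"
        using F_mult[OF z, of a] by (simp add: F_def mult.commute)
      then have "b * p = 0" using iter[of p] g[of "b * p" z] by fastforce
      then have "b = 0" using p by simp
      then show ?thesis using A[of a 0] e by (simp add: F_def)
    next
      case False
      \<comment> \<open>In \<open>b\<close> times the period of \<open>z\<close>, the red part
        \<open>q * b\<close> is traded for \<open>a * q\<close> blue steps by \<open>iter\<close> at
        \<open>q\<close>.\<close>
      have "(f ^^ (p * b + a * q)) z = z"
        using F_mult[OF z, of b] iter[of q] by (simp add: F_def funpow_add mult.commute)
      then have "p * b + a * q = 0" using f False by blast
      then show ?thesis using False p by simp
    qed
  qed
  with A show ?thesis unfolding aperiodic_at_def by blast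
qed

text \<open>Subtracting the two degrees gives a period of \<open>x\<close>, of the first kind if
  they are comparable and of the second kind otherwise.\<close>

lemma aperiodic_at_unique_degree:
  assumes ap: "aperiodic_at x" and e: "F p q y = x" "F p' q' y = x"
  shows "p = p' \<and> q = q'"
proof -
  have A: "\<And>a b. F a b x = x \<Longrightarrow> a = 0 \<and> b = 0"
    and B: "\<And>a b. (f ^^ a) x = (g ^^ b) x \<Longrightarrow> a = 0 \<and> b = 0"
    using ap unfolding aperiodic_at_def by blast+
  have le: "a = a' \<and> b = b'" if "F a b y = x" "F a' b' y = x" "a' \<le> a" for a b a' b'
  proof (cases "b' \<le> b")
    case True
    then have "F (a - a') (b - b') x = x"
      using F_add[of "a - a'" a' "b - b'" b' y] that by simp
    with A True that(3) show ?thesis by (metis diff_is_0_eq le_antisym)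
  next
    case False
    \<comment> \<open>The ancestor of \<open>y\<close> at the coordinatewise minimum of both
      degrees; from it, \<open>x\<close> is reached by blue steps alone and also by red steps
      alone.\<close>
    define y' where "y' = F a' b y"
    have 1: "(f ^^ (a - a')) y' = x"
      using F_add[of "a - a'" a' 0 b y] that by (simp add: y'_def F_def)
    have 2: "(g ^^ (b' - b)) y' = x"
      using F_add[of 0 a' "b' - b" b y] that False by (simp add: y'_def F_def)
    have "(f ^^ (a - a')) x = (f ^^ (a - a')) ((g ^^ (b' - b)) y')" by (simp only: 2)
    also have "\<dots> = (g ^^ (b' - b)) x" by (simp only: funpow_comm 1)
    finally have "b' - b = 0" using B by blast
    with False show ?thesis by simp
  qed
  show ?thesis
    using le[OF e] le[OF e(2,1)] by (cases "p' \<le> p") auto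
qed

end

lemma commuting_maps_swap:
  assumes "commuting_maps f g" shows "commuting_maps g f"
  using assms by (simp add: commuting_maps_def)

text \<open>Lets type 2b reuse \<open>aperiodic_child\<close> with the colours exchanged.\<close>

lemma aperiodic_at_swap:
  assumes "commuting_maps f g" "commuting_maps.aperiodic_at g f x"
  shows "commuting_maps.aperiodic_at f g x"
proof -
  interpret A: commuting_maps f g by fact
  interpret B: commuting_maps g f using assms(1) by (rule commuting_maps_swap)
  have F: "B.F b a y = A.F a b y" for a b y
    by (simp add: A.F_def B.F_def A.funpow_comm)
  have "A.F a b x = x \<Longrightarrow> a = 0 \<and> b = 0" for a b
    using assms(2) unfolding B.aperiodic_at_def F by blast
  moreover have "(f ^^ a) x = (g ^^ b) x \<Longrightarrow> a = 0 \<and> b = 0" for a b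
    using assms(2) unfolding B.aperiodic_at_def by metis
  ultimately show ?thesis unfolding A.aperiodic_at_def by blast
qed

section \<open>Inner products and orthonormal bases\<close>

lemma cinner_scaleC_right: "cinner x (c *\<^sub>C y) = cnj c * cinner x (y :: 'h::chilbert_space)"
  by (metis cinner_commute cinner_scaleC_left complex_cnj_mult)

lemma cinner_add_right: "cinner x (y + z) = cinner x y + cinner x (z :: 'h::chilbert_space)"
  by (metis cinner_add_left cinner_commute complex_cnj_add)

lemma scaleC_zero_left [simp]: "0 *\<^sub>C (x :: 'h::chilbert_space) = 0"
  using scaleR_scaleC[of 0 x] by simp

lemma scaleC_one [simp]: "1 *\<^sub>C (x :: 'h::chilbert_space) = x"
  using scaleR_scaleC[of 1 x] by simp

lemma cinner_zero_left [simp]: "cinner 0 (y :: 'h::chilbert_space) = 0"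
  using cinner_scaleC_left[of 0 y y] by simp

lemma cinner_sum_left: "cinner (\<Sum>i\<in>I. x i) (y :: 'h::chilbert_space) = (\<Sum>i\<in>I. cinner (x i) y)"
  by (induction I rule: infinite_finite_induct) (simp_all add: cinner_add_left)

lemma norm_sq_cinner: "(norm (x :: 'h::chilbert_space))\<^sup>2 = Re (cinner x x)"
  by (simp add: norm_eq_sqrt_cinner cinner_ge_zero)

text \<open>Reduces continuity of the inner product to continuity of the norm.\<close>

lemma Re_cinner_polarization:
  "Re (cinner x (y :: 'h::chilbert_space)) = ((norm (x + y))\<^sup>2 - (norm x)\<^sup>2 - (norm y)\<^sup>2) / 2"
proof -
  have "Re (cinner y x) = Re (cinner x y)"
    by (subst cinner_commute) simp
  then show ?thesis
    by (simp add: norm_sq_cinner cinner_add_left cinner_add_right)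
qed

lemma Im_cinner: "Im (cinner x (y :: 'h::chilbert_space)) = Re (cinner x (\<i> *\<^sub>C y))"
  by (simp add: cinner_scaleC_right)

lemma continuous_on_cinner_left:
  "continuous_on UNIV (\<lambda>x. cinner x (y :: 'h::chilbert_space))"
  by (subst complex_eq, unfold Im_cinner Re_cinner_polarization)
    (intro continuous_intros, simp_all)

lemma orthonormal_basis_cinner:
  "orthonormal_basis \<xi> \<Longrightarrow> cinner (\<xi> k) (\<xi> l) = (if k = l then 1 else 0)"
  by (simp add: orthonormal_basis_def)

lemma scaleC_basis_inj:
  assumes "orthonormal_basis \<xi>" "c *\<^sub>C \<xi> k = d *\<^sub>C \<xi> l" "c \<noteq> 0"
  shows "k = l"
proof (rule ccontr)
  assume "k \<noteq> l"
  then have "cinner (c *\<^sub>C \<xi> k) (\<xi> k) = 0"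
    unfolding assms(2) by (simp add: cinner_scaleC_left orthonormal_basis_cinner[OF assms(1)])
  then show False
    using assms(3) by (simp add: cinner_scaleC_left orthonormal_basis_cinner[OF assms(1)])
qed

text \<open>Deriving properties of \<open>cadjoint\<close>, which is given by a choice operator, would need the Riesz
  representation theorem; testing orthogonality to a range on the total set \<open>range \<xi>\<close> avoids it.\<close>

lemma cinner_range_zero:
  fixes A :: "'h::chilbert_space \<Rightarrow> 'h"
  assumes b: "orthonormal_basis \<xi>" and A: "bounded_clinear A"
    and z: "\<And>k. cinner (A (\<xi> k)) y = 0"
  shows "cinner (A x) y = 0"
proof -
  have lin: "bounded_linear A" "\<And>c x. A (c *\<^sub>C x) = c *\<^sub>C A x"
    using A by (auto simp: bounded_clinear_def)
  interpret bounded_linear A by fact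
  interpret V: vector_space "scaleC :: complex \<Rightarrow> 'h \<Rightarrow> 'h" by (rule vector_space_scaleC)
  let ?W = "{x. cinner (A x) y = 0}"
  have "V.subspace ?W"
    by (auto simp: V.subspace_def add zero lin(2) cinner_add_left cinner_scaleC_left)
  then have "V.span (range \<xi>) \<subseteq> ?W"
    using z by (intro V.span_minimal) auto
  moreover have "closed ?W"
  proof (rule closed_Collect_eq)
    show "continuous_on UNIV (\<lambda>x. cinner (A x) y)"
      by (rule continuous_on_compose2[OF continuous_on_cinner_left])
        (auto intro: linear_continuous_on lin(1))
  qed simp
  ultimately have "closure (V.span (range \<xi>)) \<subseteq> ?W" by (rule closure_minimal)
  then show ?thesis using b by (auto simp: orthonormal_basis_def)
qed

section \<open>Index maps of an atomic Cuntz family\<close>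

text \<open>The phases stay existential: cycles in the graphs and orthogonality of basis vectors do
  not depend on them.\<close>

definition index_map :: "('i \<Rightarrow> 'h::chilbert_space \<Rightarrow> 'h) \<Rightarrow> (nat \<Rightarrow> 'h) \<Rightarrow> ('i \<Rightarrow> nat \<Rightarrow> nat) \<Rightarrow> bool"
  where "index_map A \<xi> \<sigma> \<longleftrightarrow> (\<forall>i k. \<exists>c. cmod c = 1 \<and> A i (\<xi> k) = c *\<^sub>C \<xi> (\<sigma> i k))"

text \<open>The left inverses \<open>cadjoint (A i)\<close> make the index maps injective with
  disjoint ranges; the sum relation makes the ranges cover all indices.\<close>

lemma cuntz_family_index_map:
  assumes C: "cuntz_family A" and b: "orthonormal_basis \<xi>"
    and at: "\<And>i k. \<exists>c l. (cmod c = 1 \<or> c = 0) \<and> A i (\<xi> k) = c *\<^sub>C \<xi> l"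
  obtains \<sigma> where "index_map A \<xi> \<sigma>" "bij (\<lambda>(i, k). \<sigma> i k)"
proof -
  have lin: "bounded_clinear (A i)" and scl: "A i (c *\<^sub>C x) = c *\<^sub>C A i x"
    and iso: "cadjoint (A i) (A j x) = (if i = j then x else 0)"
    and tot: "(\<Sum>i\<in>UNIV. A i (cadjoint (A i) x)) = x" for i j x c
    using C by (auto simp: cuntz_family_def bounded_clinear_def)
  have nz: "\<xi> k \<noteq> 0" for k
    using orthonormal_basis_cinner[OF b, of k k] by auto
  have A0: "A i 0 = 0" for i using scl[of i 0 0] by simp
  have "\<exists>l c. cmod c = 1 \<and> A i (\<xi> k) = c *\<^sub>C \<xi> l" for i k
  proof -
    have "A i (\<xi> k) \<noteq> 0"
      using iso[of i i "\<xi> k"] iso[of i i 0] A0[of i] nz[of k] by auto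
    then show ?thesis using at[of i k] by force
  qed
  then obtain \<sigma> where s: "\<And>i k. \<exists>c. cmod c = 1 \<and> A i (\<xi> k) = c *\<^sub>C \<xi> (\<sigma> i k)"
    by metis
  have inj: "i = j \<and> k = l" if e: "\<sigma> i k = \<sigma> j l" for i j k l
  proof -
    obtain c where c: "cmod c = 1" "A i (\<xi> k) = c *\<^sub>C \<xi> (\<sigma> i k)" using s by blast
    obtain d where d: "cmod d = 1" "A j (\<xi> l) = d *\<^sub>C \<xi> (\<sigma> j l)" using s by blast
    have "d \<noteq> 0" using d(1) by auto
    \<comment> \<open>Once the phases are divided out, \<open>cadjoint (A i)\<close> recovers
      \<open>\<xi> k\<close> on the left and gives 0 on the right unless
      \<open>i = j\<close>.\<close>
    then have "A i (\<xi> k) = A j ((c / d) *\<^sub>C \<xi> l)"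
      by (simp add: scl c d e scaleC_scaleC)
    then have *: "\<xi> k = (if i = j then (c / d) *\<^sub>C \<xi> l else 0)"
      using iso[of i i "\<xi> k"] iso[of i j] by simp
    then have ij: "i = j" using nz[of k] by presburger
    with * have "1 *\<^sub>C \<xi> k = (c / d) *\<^sub>C \<xi> l" by simp
    from scaleC_basis_inj[OF b this] ij show ?thesis by simp
  qed
  have surj: "\<exists>i k. \<sigma> i k = l" for l
  proof (rule ccontr)
    assume "\<not> ?thesis"
    then have ne: "\<sigma> i k \<noteq> l" for i k by blast
    have orth: "cinner (A i (\<xi> k)) (\<xi> l) = 0" for i k
      using s[of i k] ne[of i k]
      by (auto simp: cinner_scaleC_left orthonormal_basis_cinner[OF b])
    have "cinner (A i x) (\<xi> l) = 0" for i x
      by (rule cinner_range_zero[OF b lin orth])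
    \<comment> \<open>The sum is \<open>\<xi> l\<close> itself, so this would make
      \<open>\<xi> l\<close> orthogonal to itself.\<close>
    then have "cinner (\<Sum>i\<in>UNIV. A i (cadjoint (A i) (\<xi> l))) (\<xi> l) = 0"
      by (simp add: cinner_sum_left)
    then show False by (simp add: tot orthonormal_basis_cinner[OF b])
  qed
  have "bij (\<lambda>(i, k). \<sigma> i k)"
  proof (rule bijI)
    show "inj (\<lambda>(i, k). \<sigma> i k)" using inj by (auto intro!: injI)
    show "surj (\<lambda>(i, k). \<sigma> i k)" using surj by (simp add: surj_def) metis
  qed
  then show thesis using s by (intro that) (simp_all add: index_map_def)
qed

text \<open>The input carries a phase so that a blue word can be applied to the output of a red
  word.\<close>

lemma index_map_foldr:
  assumes i: "index_map A \<xi> \<sigma>" and lin: "\<And>i. bounded_clinear (A i)"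
    and x: "cmod c = 1" "x = c *\<^sub>C \<xi> k"
  shows "\<exists>d. cmod d = 1 \<and> foldr A u x = d *\<^sub>C \<xi> (foldr \<sigma> u k)"
proof (induction u)
  case Nil
  then show ?case using x by auto
next
  case (Cons a u)
  then obtain d where d: "cmod d = 1" "foldr A u x = d *\<^sub>C \<xi> (foldr \<sigma> u k)" by blast
  obtain e where e: "cmod e = 1" "A a (\<xi> (foldr \<sigma> u k)) = e *\<^sub>C \<xi> (\<sigma> a (foldr \<sigma> u k))"
    using i unfolding index_map_def by blast
  have "foldr A (a # u) x = (d * e) *\<^sub>C \<xi> (foldr \<sigma> (a # u) k)"
    using lin[of a] d e by (simp add: bounded_clinear_def scaleC_scaleC)
  then show ?case using d e by (metis mult_1 norm_mult)
qed

text \<open>For a bijection, the source of the unique edge into \<open>l\<close>; the discarded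
  first component is the label of that edge.\<close>

definition parent :: "('i \<Rightarrow> nat \<Rightarrow> nat) \<Rightarrow> nat \<Rightarrow> nat" where
  "parent \<sigma> l = snd (inv_into UNIV (\<lambda>(i, k). \<sigma> i k) l)"

context
  fixes \<sigma> :: "'i \<Rightarrow> nat \<Rightarrow> nat"
  assumes bij: "bij (\<lambda>(i, k). \<sigma> i k)"
begin

lemma parent_image: "parent \<sigma> (\<sigma> i k) = k"
  using inv_f_f[OF bij_is_inj[OF bij], of "(i, k)"] by (simp add: parent_def)

lemma image_inj: "\<sigma> i k = \<sigma> j l \<Longrightarrow> i = j \<and> k = l"
  using injD[OF bij_is_inj[OF bij], of "(i, k)" "(j, l)"] by simp

lemma image_parent_exists: "\<exists>i. \<sigma> i (parent \<sigma> l) = l"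
proof -
  obtain i k where "l = \<sigma> i k" using surjD[OF bij_is_surj[OF bij], of l] by auto
  then show ?thesis by (auto simp: parent_image)
qed

lemma parent_foldr: "(parent \<sigma> ^^ length u) (foldr \<sigma> u k) = k"
  by (induction u) (simp_all add: funpow_Suc_right parent_image del: funpow.simps)

text \<open>Disjoint ranges let the letters be read off from the endpoint. Equal length matters: on
  a cycle, words of different lengths can share an endpoint.\<close>

lemma foldr_inj:
  "length u = length u' \<Longrightarrow> foldr \<sigma> u k = foldr \<sigma> u' k \<Longrightarrow> u = u'"
proof (induction u u' rule: list_induct2)
  case (Cons a u a' u')
  then show ?case using image_inj[of a "foldr \<sigma> u k" a' "foldr \<sigma> u' k"] by simp
qed simp

end

section \<open>Blue and red graphs\<close>

lemma unit_orbit_index: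
  assumes "orthonormal_basis \<xi>" "x \<in> unit_orbit (\<xi> k)" "x = d *\<^sub>C \<xi> l"
  shows "k = l"
proof -
  obtain c where "x = c *\<^sub>C \<xi> k" "cmod c = 1" using assms(2) by (auto simp: unit_orbit_def)
  then have "c *\<^sub>C \<xi> k = d *\<^sub>C \<xi> l" "c \<noteq> 0" using assms by auto
  then show ?thesis by (rule scaleC_basis_inj[OF assms(1)])
qed

lemma mem_unit_orbit: "x \<in> unit_orbit x"
  unfolding unit_orbit_def by (auto intro!: exI[of _ 1])

lemma unit_orbit_inj:
  assumes "orthonormal_basis \<xi>" "unit_orbit (\<xi> k) = unit_orbit (\<xi> l)"
  shows "k = l"
  using unit_orbit_index[OF assms(1), of "\<xi> l" k 1 l] assms(2) mem_unit_orbit[of "\<xi> l"] by simp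

lemma unit_orbit_scaleC:
  assumes "cmod c = 1" shows "unit_orbit (c *\<^sub>C x) = unit_orbit x"
proof (intro equalityI subsetI)
  fix y assume "y \<in> unit_orbit x"
  then obtain d where d: "cmod d = 1" "y = d *\<^sub>C x" by (auto simp: unit_orbit_def)
  have "c \<noteq> 0" using assms by auto
  then have "y = (d / c) *\<^sub>C (c *\<^sub>C x)" "cmod (d / c) = 1"
    using assms d by (simp_all add: scaleC_scaleC norm_divide)
  then show "y \<in> unit_orbit (c *\<^sub>C x)" unfolding unit_orbit_def by blast
next
  fix y assume "y \<in> unit_orbit (c *\<^sub>C x)"
  then obtain d where "cmod d = 1" "y = (d * c) *\<^sub>C x"
    by (auto simp: unit_orbit_def scaleC_scaleC)
  then show "y \<in> unit_orbit x"
    using assms by (auto simp: unit_orbit_def norm_mult intro!: exI[of _ "d * c"])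
qed

context
  fixes A :: "'i \<Rightarrow> 'h::chilbert_space \<Rightarrow> 'h" and \<xi> \<sigma>
  assumes lin: "\<And>i. bounded_clinear (A i)" and b: "orthonormal_basis \<xi>"
    and im: "index_map A \<xi> \<sigma>" and bij: "bij (\<lambda>(i, k). \<sigma> i k)"
begin

lemma image_unit_orbit: "A i ` unit_orbit (\<xi> k) = unit_orbit (\<xi> (\<sigma> i k))"
proof -
  obtain c where c: "cmod c = 1" "A i (\<xi> k) = c *\<^sub>C \<xi> (\<sigma> i k)"
    using im unfolding index_map_def by blast
  have scl: "A i (d *\<^sub>C x) = d *\<^sub>C A i x" for d x
    using lin[of i] by (simp add: bounded_clinear_def)
  have "unit_orbit y = (\<lambda>d. d *\<^sub>C y) ` {d. cmod d = 1}" for y :: 'h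
    by (auto simp: unit_orbit_def)
  then have "A i ` unit_orbit (\<xi> k) = unit_orbit (A i (\<xi> k))"
    by (simp add: image_image scl)
  then show ?thesis using c by (simp add: unit_orbit_scaleC)
qed

text \<open>Together with \<open>edgeD\<close> this identifies the graph with that of
  \<open>parent \<sigma>\<close>, so directed cycles become periodic points.\<close>

lemma edge_parent: "(unit_orbit (\<xi> (parent \<sigma> l)), unit_orbit (\<xi> l)) \<in> edges A \<xi>"
proof -
  obtain i where "\<sigma> i (parent \<sigma> l) = l" using image_parent_exists[OF bij] by blast
  then have "A i ` unit_orbit (\<xi> (parent \<sigma> l)) = unit_orbit (\<xi> l)"
    by (simp add: image_unit_orbit)
  then show ?thesis by (auto simp: edges_def vertices_def)
qed

lemma edgeD:
  assumes "(x, unit_orbit (\<xi> l)) \<in> edges A \<xi>"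
  shows "x = unit_orbit (\<xi> (parent \<sigma> l))"
proof -
  from assms obtain k i where k: "x = unit_orbit (\<xi> k)" "A i ` x = unit_orbit (\<xi> l)"
    by (auto simp: edges_def vertices_def)
  then have "unit_orbit (\<xi> (\<sigma> i k)) = unit_orbit (\<xi> l)" by (simp add: image_unit_orbit)
  then have "\<sigma> i k = l" by (rule unit_orbit_inj[OF b])
  with k parent_image[OF bij] show ?thesis by metis
qed

lemma path_parent:
  "n > 0 \<Longrightarrow> (unit_orbit (\<xi> ((parent \<sigma> ^^ n) l)), unit_orbit (\<xi> l)) \<in> (edges A \<xi>)\<^sup>+"
proof (induction n)
  case (Suc n)
  have e: "(unit_orbit (\<xi> ((parent \<sigma> ^^ Suc n) l)), unit_orbit (\<xi> ((parent \<sigma> ^^ n) l))) \<in> edges A \<xi>"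
    using edge_parent[of "(parent \<sigma> ^^ n) l"] by simp
  show ?case
  proof (cases "n = 0")
    case True
    then show ?thesis using e by auto
  next
    case False
    then show ?thesis using Suc.IH trancl_into_trancl2[OF e] by simp
  qed
qed simp

lemma pathD:
  assumes "(x, y) \<in> (edges A \<xi>)\<^sup>+" "y = unit_orbit (\<xi> l)"
  shows "\<exists>n>0. x = unit_orbit (\<xi> ((parent \<sigma> ^^ n) l))"
  using assms(1)
proof (induction rule: converse_trancl_induct)
  case (base x)
  then have "x = unit_orbit (\<xi> ((parent \<sigma> ^^ 1) l))" using edgeD assms(2) by simp
  then show ?case by blast
next
  case (step x z)
  then obtain n where n: "n > 0" "z = unit_orbit (\<xi> ((parent \<sigma> ^^ n) l))" by blast
  then have "x = unit_orbit (\<xi> ((parent \<sigma> ^^ Suc n) l))" using step(1) edgeD by simp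
  then show ?case by blast
qed

lemma infinite_tail_parent:
  assumes "infinite_tail_type A \<xi>" "n > 0"
  shows "(parent \<sigma> ^^ n) l \<noteq> l"
  using path_parent[OF assms(2), of l] assms(1)
  by (auto simp: infinite_tail_type_def acyclic_def)

lemma ring_parent:
  assumes "ring_type A \<xi>"
  shows "\<exists>n>0. \<exists>l. (parent \<sigma> ^^ n) l = l"
proof -
  let ?E = "edges A \<xi>"
  \<comment> \<open>A single cycle is enough, so any component will do; that of
    \<open>\<xi> 0\<close> shows that one exists.\<close>
  have "(?E \<union> ?E\<inverse>)\<^sup>* `` {unit_orbit (\<xi> 0)} \<in> components (vertices \<xi>) ?E"
    unfolding components_def by (rule quotientI) (simp add: vertices_def)
  then obtain C where "\<not> acyclic (?E \<inter> C \<times> C)"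
    using assms unfolding ring_type_def by blast
  then obtain x where "(x, x) \<in> (?E \<inter> C \<times> C)\<^sup>+" by (auto simp: acyclic_def)
  then have x: "(x, x) \<in> ?E\<^sup>+" by (rule trancl_mono) auto
  then obtain y where "(y, x) \<in> ?E" by (metis tranclE)
  then obtain l where l: "x = unit_orbit (\<xi> l)" by (auto simp: edges_def vertices_def)
  from pathD[OF x l] obtain n where n: "n > 0" "unit_orbit (\<xi> l) = unit_orbit (\<xi> ((parent \<sigma> ^^ n) l))"
    using l by auto
  with unit_orbit_inj[OF b n(2)] show ?thesis by metis
qed

end

section \<open>Wandering vectors\<close>

lemma carrier_F_theta_normal_form:
  assumes "bij \<theta>" "w \<in> carrier (F_theta \<theta>)"
  shows "w = e_word \<theta> (fst (normal_form \<theta> w)) \<otimes>\<^bsub>F_theta \<theta>\<^esub> f_word \<theta> (snd (normal_form \<theta> w))"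
  unfolding normal_form_def by (rule theI'[OF normal_form_unique[OF assms]])

lemma word_in_carrier: "e_word \<theta> u \<otimes>\<^bsub>F_theta \<theta>\<^esub> f_word \<theta> v \<in> carrier (F_theta \<theta>)"
  unfolding e_word_def f_word_def mult_F_theta
  by (auto simp: F_theta_def intro!: quotientI)

lemma rep_op_word:
  assumes "bij \<theta>"
  shows "rep_op \<theta> S T (e_word \<theta> u \<otimes>\<^bsub>F_theta \<theta>\<^esub> f_word \<theta> v) = foldr S u \<circ> foldr T v"
proof -
  let ?w = "e_word \<theta> u \<otimes>\<^bsub>F_theta \<theta>\<^esub> f_word \<theta> v"
  have "normal_form \<theta> ?w = (u, v)"
    unfolding normal_form_def
    by (rule the1_equality[OF normal_form_unique[OF assms word_in_carrier]]) simp
  then show ?thesis by (simp add: rep_op_def)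
qed

lemma atomic_wrt_word:
  assumes "bij \<theta>" "atomic_wrt \<theta> S T \<xi>"
  shows "\<exists>c l. (cmod c = 1 \<or> c = 0) \<and> foldr S u (foldr T v (\<xi> k)) = c *\<^sub>C \<xi> l"
proof -
  let ?w = "e_word \<theta> u \<otimes>\<^bsub>F_theta \<theta>\<^esub> f_word \<theta> v"
  have "\<exists>c l. (cmod c = 1 \<or> c = 0) \<and> rep_op \<theta> S T ?w (\<xi> k) = c *\<^sub>C \<xi> l"
    using assms(2) word_in_carrier unfolding atomic_wrt_def by blast
  then show ?thesis by (simp add: rep_op_word[OF assms(1)])
qed

text \<open>This is where having at least two generators of a colour enters.\<close>

lemma exists_distinct_children:
  fixes \<sigma> :: "'i::finite \<Rightarrow> nat \<Rightarrow> nat"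
  assumes "bij (\<lambda>(i, k). \<sigma> i k)" "CARD('i) \<ge> 2"
  shows "\<exists>x1 x2. parent \<sigma> x1 = z \<and> parent \<sigma> x2 = z \<and> x1 \<noteq> x2"
proof -
  have "\<not> CARD('i) \<le> Suc 0" using assms(2) by simp
  then obtain i j :: 'i where "i \<noteq> j"
    by (auto simp: card_le_Suc0_iff_eq)
  then have "\<sigma> i z \<noteq> \<sigma> j z" using image_inj[OF assms(1)] by blast
  then show ?thesis using parent_image[OF assms(1)] by blast
qed

theorem proposition6p3:
  fixes \<theta> :: "'m::finite \<times> 'n::finite \<Rightarrow> 'm \<times> 'n"
    and S :: "'m \<Rightarrow> 'h::chilbert_space \<Rightarrow> 'h"
    and T :: "'n \<Rightarrow> 'h \<Rightarrow> 'h"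
    and \<xi> :: "nat \<Rightarrow> 'h"
  assumes "CARD('m) \<ge> 2" and "CARD('n) \<ge> 2"
    and "bij \<theta>"
    and "cuntz_type_rep \<theta> S T"
    and "atomic_wrt \<theta> S T \<xi>"
    and "irreducible_rep S T"
    and "type_2 S T \<xi> \<or> type_3bi S T \<xi>"
  shows "\<exists>\<zeta>. wandering \<theta> S T \<zeta>"
proof -
  have b: "orthonormal_basis \<xi>" using assms(5) by (simp add: atomic_wrt_def)
  have cS: "cuntz_family S" and cT: "cuntz_family T"
    and rel: "\<And>i j i' j'. \<theta> (i, j) = (i', j') \<Longrightarrow> S i \<circ> T j = T j' \<circ> S i'"
    using assms(4) by (auto simp: cuntz_type_rep_def)
  have linS: "bounded_clinear (S i)" and linT: "bounded_clinear (T j)" for i j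
    using cS cT by (auto simp: cuntz_family_def)
  have atS: "\<exists>c l. (cmod c = 1 \<or> c = 0) \<and> S i (\<xi> k) = c *\<^sub>C \<xi> l"
    and atT: "\<exists>c l. (cmod c = 1 \<or> c = 0) \<and> T j (\<xi> k) = c *\<^sub>C \<xi> l" for i j k
    using atomic_wrt_word[OF assms(3,5), of "[i]" "[]" k]
      atomic_wrt_word[OF assms(3,5), of "[]" "[j]" k] by simp_all
  obtain \<sigma> where s: "index_map S \<xi> \<sigma>" "bij (\<lambda>(i, k). \<sigma> i k)"
    by (rule cuntz_family_index_map[OF cS b atS])
  obtain \<tau> where t: "index_map T \<xi> \<tau>" "bij (\<lambda>(j, k). \<tau> j k)"
    by (rule cuntz_family_index_map[OF cT b atT])
  have word: "\<exists>c. cmod c = 1 \<and> foldr S u (foldr T v (\<xi> k)) = c *\<^sub>C \<xi> (foldr \<sigma> u (foldr \<tau> v k))"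
    for u v k
  proof -
    obtain d where "cmod d = 1" "foldr T v (\<xi> k) = d *\<^sub>C \<xi> (foldr \<tau> v k)"
      using index_map_foldr[OF t(1) linT, of 1 "\<xi> k" k v] by auto
    then show ?thesis by (rule index_map_foldr[OF s(1) linS])
  qed
  let ?f = "parent \<sigma>" and ?g = "parent \<tau>"
  have "?f (?g y) = ?g (?f y)" for y
  proof -
    \<comment> \<open>Here \<open>k\<close> is the red parent of the blue parent of
      \<open>y\<close>. Rewriting the path from \<open>k\<close> to \<open>y\<close> by
      \<open>\<theta>\<close> makes \<open>k\<close> also the blue parent of the red parent.\<close>
    obtain i j k where y: "y = \<sigma> i (\<tau> j k)"
      using image_parent_exists[OF s(2), of y] image_parent_exists[OF t(2)] by metis
    obtain i' j' where ij: "\<theta> (i, j) = (i', j')" by fastforce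
    obtain c where c: "cmod c = 1" "S i (T j (\<xi> k)) = c *\<^sub>C \<xi> y"
      using word[of "[i]" "[j]" k] y by auto
    obtain d where d: "cmod d = 1" "S i' (\<xi> k) = d *\<^sub>C \<xi> (\<sigma> i' k)"
      using s(1) unfolding index_map_def by blast
    obtain e where e: "cmod e = 1" "T j' (S i' (\<xi> k)) = e *\<^sub>C \<xi> (\<tau> j' (\<sigma> i' k))"
      using index_map_foldr[OF t(1) linT d, of "[j']"] by auto
    have "c *\<^sub>C \<xi> y = e *\<^sub>C \<xi> (\<tau> j' (\<sigma> i' k))"
      using fun_cong[OF rel[OF ij], of "\<xi> k"] c e by simp
    moreover have "c \<noteq> 0" using c by auto
    ultimately have "y = \<tau> j' (\<sigma> i' k)" by (rule scaleC_basis_inj[OF b])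
    then show ?thesis
      using y parent_image[OF s(2)] parent_image[OF t(2)] by metis
  qed
  then interpret commuting_maps ?f ?g by unfold_locales
  have comm': "commuting_maps ?g ?f" by (rule commuting_maps_swap) unfold_locales
  note ringS = ring_parent[OF linS b s] and ringT = ring_parent[OF linT b t]
  note tailS = infinite_tail_parent[OF linS b s] and tailT = infinite_tail_parent[OF linT b t]
  have "\<exists>x. aperiodic_at x"
    using assms(7) unfolding type_2_def
  proof (elim disjE)
    assume "type_2a S T \<xi>"
    then have 1: "ring_type S \<xi>" "infinite_tail_type T \<xi>" by (auto simp: type_2a_def)
    obtain n z where n: "n > 0" "(?f ^^ n) z = z" using ringS[OF 1(1)] by blast
    obtain x1 x2 where "?f x1 = z" "?f x2 = z" "x1 \<noteq> x2"
      using exists_distinct_children[OF s(2) assms(1)] by blast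
    then show ?thesis
      using n by (intro aperiodic_child[OF tailT[OF 1(2)], of 0 n z x1 x2]) (auto simp: F_def)
  next
    assume "type_2b S T \<xi>"
    then have 1: "ring_type T \<xi>" "infinite_tail_type S \<xi>" by (auto simp: type_2b_def)
    obtain n z where n: "n > 0" "(?g ^^ n) z = z" using ringT[OF 1(1)] by blast
    obtain x1 x2 where "?g x1 = z" "?g x2 = z" "x1 \<noteq> x2"
      using exists_distinct_children[OF t(2) assms(2)] by blast
    \<comment> \<open>With the colours exchanged, the red cycle is the period
      \<open>(n, 0)\<close>.\<close>
    then have "\<exists>x. commuting_maps.aperiodic_at ?g ?f x"
      using n by (intro commuting_maps.aperiodic_child[OF comm' tailS[OF 1(2)], of 0 n z x1 x2])
        (auto simp: commuting_maps.F_def[OF comm'])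
    then show ?thesis
      using aperiodic_at_swap[of ?f ?g] commuting_maps_axioms by blast
  next
    assume "type_3bi S T \<xi>"
    then obtain k u v where 1: "infinite_tail_type S \<xi>" "infinite_tail_type T \<xi>" "u \<noteq> []"
      and im: "(foldr S u \<circ> foldr T v) ` unit_orbit (\<xi> k) = unit_orbit (\<xi> k)"
      unfolding type_3bi_def by blast
    obtain c where c: "foldr S u (foldr T v (\<xi> k)) = c *\<^sub>C \<xi> (foldr \<sigma> u (foldr \<tau> v k))"
      using word by blast
    have "foldr S u (foldr T v (\<xi> k)) \<in> unit_orbit (\<xi> k)"
      using im mem_unit_orbit[of "\<xi> k"] by (metis comp_apply imageI)
    then have k: "foldr \<sigma> u (foldr \<tau> v k) = k"
      using unit_orbit_index[OF b _ c] by simp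
    \<comment> \<open>The fixed vertex turns the lengths of the two words into a period, with
      positive blue part because \<open>u\<close> is nonempty.\<close>
    have F: "F (length u) (length v) k = k"
      using parent_foldr[OF s(2), of u "foldr \<tau> v k"] parent_foldr[OF t(2), of v k]
      by (simp add: F_def k funpow_comm)
    obtain x1 x2 where "?f x1 = k" "?f x2 = k" "x1 \<noteq> x2"
      using exists_distinct_children[OF s(2) assms(1)] by blast
    then show ?thesis
      using F 1(3) tailS[OF 1(1)]
      by (intro aperiodic_child[OF tailT[OF 1(2)], of "length v" "length u" k x1 x2]) auto
  qed
  then obtain x where x: "aperiodic_at x" by blast
  have degree: "F (length u) (length v) (foldr \<sigma> u (foldr \<tau> v x)) = x" for u v
    using parent_foldr[OF s(2), of u "foldr \<tau> v x"] parent_foldr[OF t(2), of v x]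
    by (simp add: F_def funpow_comm)
  have word_inj: "u = u' \<and> v = v'"
    if e: "foldr \<sigma> u (foldr \<tau> v x) = foldr \<sigma> u' (foldr \<tau> v' x)" for u v u' v'
  proof -
    have len: "length u = length u'" "length v = length v'"
      using aperiodic_at_unique_degree[OF x degree[of u v]] degree[of u' v'] e by auto
    \<comment> \<open>Climbing \<open>length u\<close> blue steps strips both blue words.\<close>
    have v: "foldr \<tau> v x = foldr \<tau> v' x"
      using e len parent_foldr[OF s(2)] by metis
    then have "foldr \<sigma> u (foldr \<tau> v x) = foldr \<sigma> u' (foldr \<tau> v x)" using e by simp
    then show ?thesis
      using foldr_inj[OF s(2) len(1)] foldr_inj[OF t(2) len(2) v] by blast
  qed
  have "wandering \<theta> S T (\<xi> x)"
    unfolding wandering_def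
  proof (intro conjI ballI)
    show "norm (\<xi> x) = 1" by (simp add: norm_eq_sqrt_cinner orthonormal_basis_cinner[OF b])
  next
    fix w w' assume w: "w \<in> carrier (F_theta \<theta>)" "w' \<in> carrier (F_theta \<theta>)"
    obtain u v where n: "normal_form \<theta> w = (u, v)" by fastforce
    obtain u' v' where n': "normal_form \<theta> w' = (u', v')" by fastforce
    obtain c where c: "cmod c = 1" "rep_op \<theta> S T w (\<xi> x) = c *\<^sub>C \<xi> (foldr \<sigma> u (foldr \<tau> v x))"
      using word[of u v x] by (auto simp: rep_op_def n)
    obtain d where d: "rep_op \<theta> S T w' (\<xi> x) = d *\<^sub>C \<xi> (foldr \<sigma> u' (foldr \<tau> v' x))"
      using word[of u' v' x] by (auto simp: rep_op_def n')
    show "cinner (rep_op \<theta> S T w (\<xi> x)) (rep_op \<theta> S T w' (\<xi> x)) = (if w = w' then 1 else 0)"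
    proof (cases "w = w'")
      case True
      have "cnj c * c = 1" using c(1) by (simp add: mult.commute complex_norm_square[symmetric])
      then show ?thesis
        unfolding True[symmetric] c(2)
        by (simp add: cinner_scaleC_left cinner_scaleC_right orthonormal_basis_cinner[OF b])
    next
      case False
      \<comment> \<open>An element is the product of its normal form, so distinct elements have
        distinct word pairs and, by \<open>word_inj\<close>, distinct endpoints.\<close>
      then have "(u, v) \<noteq> (u', v')"
        using carrier_F_theta_normal_form[OF assms(3) w(1)]
          carrier_F_theta_normal_form[OF assms(3) w(2)] n n' by metis
      then have "foldr \<sigma> u (foldr \<tau> v x) \<noteq> foldr \<sigma> u' (foldr \<tau> v' x)"
        using word_inj by blast
      then show ?thesis
        using False unfolding c(2) d
        by (simp add: cinner_scaleC_left cinner_scaleC_right orthonormal_basis_cinner[OF b])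
    qed
  qed
  then show ?thesis by blast
qed

end
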